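(* Let $\lambda$ be a regular cardinal with $\lambda=\lambda^{<\lambda}\ge\aleph_1$ and assume $\mathrm{cov}(\mathbf{M}^\lambda_{\lambda,\lambda})=2^\lambda$. Then there exists a linked and big family $H\subseteq\mathbb{Q}^0_\lambda$ such that $\mathrm{fil}(H)$ is a weakly reasonable ultrafilter on $\lambda$.
   Context: $\mathcal F^{\rm ult}$ is the set of all triples $(\alpha,Z,d)$ with $Z\subseteq\lambda$ infinite, $|Z|<\lambda$, $\alpha=\min Z$, $d$ a non-principal ultrafilter on $Z$. $\mathbb{Q}^*_\lambda$ is the family of all $r\subseteq\mathcal F^{\rm ult}$ with $|r|=\lambda$ and fewer than $\lambda$ triples of $r$ with any given first coordinate; $\mathbb{Q}^0_\lambda$ is the set of $r\in\mathbb{Q}^*_\lambda$ that are strongly disjoint: at most one triple has any given first coordinate, and $(\alpha_1,Z_1,d_1),(\alpha_2,Z_2,d_2)\in r$ with $\alpha_1<\alpha_2$ implies $Z_1\subseteq\alpha_2$. $\mathrm{fil}(r)=\{A\subseteq\lambda:\exists\varepsilon<\lambda\ \forall(\alpha,Z,d)\in r\ (\varepsilon\le\alpha\Rightarrow A\cap Z\in d)\}$, $\mathrm{fil}(H)=\bigcup_{r\in H}\mathrm{fil}(r)$. For $p\in\mathbb{Q}^*_\lambda$, $\Sigma(p)$ is the set of $(\alpha,Z,d)\in\mathcal F^{\rm ult}$ such that for every $A\in d$ there is $(\alpha',Z',d')\in p$ with $A\cap Z'\in d'$. A nonempty $H\subseteq\mathbb{Q}^*_\lambda$ is big if for every $\mathcal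 D\subseteq\mathcal F^{\rm ult}$ some $q\in H$ satisfies $q\subseteq\mathcal D$ or $q\cap\mathcal D=\emptyset$; it is linked if for all $p_0,\dots,p_n\in H$ ($n<\omega$) the set $\{\alpha:\exists Z,d\ ((\alpha,Z,d)\in\Sigma(p_0)\cap\dots\cap\Sigma(p_n))\}$ has size $\lambda$. The space ${}^\lambda\lambda$ carries the topology with basic open sets $O_s=\{f:s\subseteq f\}$, $s\in{}^{<\lambda}\lambda$; $\mathbf{M}^\lambda_{\lambda,\lambda}$ is the $({<}\lambda^+)$-complete ideal generated by nowhere dense subsets of ${}^\lambda\lambda$, and $\mathrm{cov}(\mathbf{M}^\lambda_{\lambda,\lambda})$ is the least size of a subfamily of this ideal covering ${}^\lambda\lambda$. A uniform ultrafilter $D$ on $\lambda$ is weakly reasonable if for every non-decreasing unbounded $f:\lambda\to\lambda$ there is a club $C$ with $\bigcup\{[\delta,\delta+f(\delta)):\delta\in C\}\notin D$. *)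

theory Defs
  imports "HOL-Analysis.Abstract_Topology"
begin

unbundle cardinal_syntax

text \<open>
  The cardinal \<open>\<lambda>\<close> is represented by a well-ordered type \<open>'a\<close>: its elements are the ordinals below
  \<open>\<lambda>\<close>, the ordinal \<open>\<alpha> < \<lambda>\<close> as a set is \<open>{..<\<alpha>}\<close>, and subsets of \<open>\<lambda>\<close> are the sets over \<open>'a\<close>.
  That the order type of \<open>'a\<close> is a cardinal is the hypothesis \<open>Card_order lam\<close>.
\<close>

definition lam :: "('a::wellorder) rel" where
  "lam = {(x, y). x \<le> y}"

text \<open>\<open>ord_add \<alpha> \<beta>\<close> is the ordinal sum: \<open>[\<alpha>, \<alpha> + \<beta>)\<close> has order type \<open>\<beta>\<close>.\<close>

definition ord_add :: "'a::wellorder \<Rightarrow> 'a \<Rightarrow> 'a" where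
  "ord_add \<alpha> \<beta> = (THE \<gamma>. \<alpha> \<le> \<gamma> \<and> Restr lam {\<alpha>..<\<gamma>} =o Restr lam {..<\<beta>})"

definition ultrafilter_on :: "'b set \<Rightarrow> 'b set set \<Rightarrow> bool" where
  "ultrafilter_on Z d \<longleftrightarrow>
     d \<subseteq> Pow Z \<and> Z \<in> d \<and> {} \<notin> d \<and>
     (\<forall>A\<in>d. \<forall>B. A \<subseteq> B \<and> B \<subseteq> Z \<longrightarrow> B \<in> d) \<and>
     (\<forall>A\<in>d. \<forall>B\<in>d. A \<inter> B \<in> d) \<and>
     (\<forall>A. A \<subseteq> Z \<longrightarrow> A \<in> d \<or> Z - A \<in> d)"

definition nonprincipal_on :: "'b set \<Rightarrow> 'b set set \<Rightarrow> bool" where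
  "nonprincipal_on Z d \<longleftrightarrow> \<not> (\<exists>x\<in>Z. d = {A. A \<subseteq> Z \<and> x \<in> A})"

type_synonym 'a triple = "'a \<times> 'a set \<times> 'a set set"

definition F_ult :: "('a::wellorder) triple set" where
  "F_ult = {(\<alpha>, Z, d). infinite Z \<and> |Z| <o (lam :: 'a rel) \<and> \<alpha> = (LEAST z. z \<in> Z) \<and>
                       ultrafilter_on Z d \<and> nonprincipal_on Z d}"

definition Q_star :: "('a::wellorder) triple set set" where
  "Q_star = {r. r \<subseteq> F_ult \<and> |r| =o (lam :: 'a rel) \<and>
                (\<forall>\<alpha>. |{t \<in> r. fst t = \<alpha>}| <o (lam :: 'a rel))}"

definition strongly_disjoint :: "('a::wellorder) triple set \<Rightarrow> bool" where
  "strongly_disjoint r \<longleftrightarrow>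
     (\<forall>t1\<in>r. \<forall>t2\<in>r. fst t1 = fst t2 \<longrightarrow> t1 = t2) \<and>
     (\<forall>\<alpha>1 Z1 d1 \<alpha>2 Z2 d2. (\<alpha>1, Z1, d1) \<in> r \<and> (\<alpha>2, Z2, d2) \<in> r \<and> \<alpha>1 < \<alpha>2 \<longrightarrow> Z1 \<subseteq> {..<\<alpha>2})"

definition Q_zero :: "('a::wellorder) triple set set" where
  "Q_zero = {r \<in> Q_star. strongly_disjoint r}"

definition fil :: "('a::wellorder) triple set \<Rightarrow> 'a set set" where
  "fil r = {A. \<exists>\<epsilon>. \<forall>(\<alpha>, Z, d)\<in>r. \<epsilon> \<le> \<alpha> \<longrightarrow> A \<inter> Z \<in> d}"

definition fil_family :: "('a::wellorder) triple set set \<Rightarrow> 'a set set" where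
  "fil_family H = (\<Union>r\<in>H. fil r)"

definition Sigma_ult :: "('a::wellorder) triple set \<Rightarrow> 'a triple set" where
  "Sigma_ult p = {(\<alpha>, Z, d) \<in> F_ult. \<forall>A\<in>d. \<exists>(\<alpha>', Z', d')\<in>p. A \<inter> Z' \<in> d'}"

definition big :: "('a::wellorder) triple set set \<Rightarrow> bool" where
  "big H \<longleftrightarrow> H \<noteq> {} \<and> H \<subseteq> Q_star \<and>
     (\<forall>\<D>. \<D> \<subseteq> F_ult \<longrightarrow> (\<exists>q\<in>H. q \<subseteq> \<D> \<or> q \<inter> \<D> = {}))"

definition linked :: "('a::wellorder) triple set set \<Rightarrow> bool" where
  "linked H \<longleftrightarrow> H \<noteq> {} \<and> H \<subseteq> Q_star \<and>
     (\<forall>(n::nat) p. (\<forall>i\<le>n. p i \<in> H) \<longrightarrow>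
        |{\<alpha>. \<exists>Z d. (\<alpha>, Z, d) \<in> (\<Inter>i\<le>n. Sigma_ult (p i))}| =o (lam :: 'a rel))"

definition club :: "('a::wellorder) set \<Rightarrow> bool" where
  "club C \<longleftrightarrow> (\<forall>\<alpha>. \<exists>\<beta>\<in>C. \<alpha> \<le> \<beta>) \<and>
     (\<forall>\<delta>. (\<exists>\<alpha>. \<alpha> < \<delta>) \<and> (\<forall>\<alpha><\<delta>. \<exists>\<beta>\<in>C. \<alpha> < \<beta> \<and> \<beta> < \<delta>) \<longrightarrow> \<delta> \<in> C)"

definition uniform_ultrafilter :: "('a::wellorder) set set \<Rightarrow> bool" where
  "uniform_ultrafilter D \<longleftrightarrow> ultrafilter_on UNIV D \<and> (\<forall>A\<in>D. |A| =o (lam :: 'a rel))"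

definition weakly_reasonable :: "('a::wellorder) set set \<Rightarrow> bool" where
  "weakly_reasonable D \<longleftrightarrow> uniform_ultrafilter D \<and>
     (\<forall>f :: 'a \<Rightarrow> 'a. mono f \<and> \<not> bdd_above (range f) \<longrightarrow>
        (\<exists>C. club C \<and> (\<Union>\<delta>\<in>C. {\<delta>..<ord_add \<delta> (f \<delta>)}) \<notin> D))"

text \<open>
  Elements of \<open>\<^bsup><\<lambda>\<^esup>\<lambda>\<close> are partial maps whose domain is an ordinal below \<open>\<lambda>\<close>, so that sequences of
  different lengths are different.
\<close>

definition bounded_seqs :: "(('a::wellorder) \<rightharpoonup> 'a) set" where
  "bounded_seqs = {s. \<exists>\<alpha>. dom s = {..<\<alpha>}}"

definition basic_open :: "('a \<rightharpoonup> 'a) \<Rightarrow> ('a \<Rightarrow> 'a) set" where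
  "basic_open s = {f. s \<subseteq>\<^sub>m (\<lambda>x. Some (f x))}"

definition lam_topology :: "(('a::wellorder) \<Rightarrow> 'a) topology" where
  "lam_topology = topology_generated_by (basic_open ` bounded_seqs)"

definition nowhere_dense_in :: "'b topology \<Rightarrow> 'b set \<Rightarrow> bool" where
  "nowhere_dense_in X A \<longleftrightarrow> A \<subseteq> topspace X \<and> X interior_of (X closure_of A) = {}"

inductive_set meagre_ideal :: "(('a::wellorder) \<Rightarrow> 'a) set set" where
  nowhere_dense: "nowhere_dense_in lam_topology A \<Longrightarrow> A \<in> meagre_ideal"
| subset: "A \<in> meagre_ideal \<Longrightarrow> B \<subseteq> A \<Longrightarrow> B \<in> meagre_ideal"
| Union: "(\<forall>A\<in>\<A>. A \<in> meagre_ideal) \<Longrightarrow> |\<A>| <o cardSuc (lam :: 'a rel) \<Longrightarrow> \<Union>\<A> \<in> meagre_ideal"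

definition meagre_cover :: "(('a::wellorder) \<Rightarrow> 'a) set set \<Rightarrow> bool" where
  "meagre_cover \<A> \<longleftrightarrow> \<A> \<subseteq> meagre_ideal \<and> \<Union>\<A> = UNIV"

text \<open>The covering number is a cardinal, determined up to \<open>=o\<close>; see \<open>cov_meagre_attained\<close>.\<close>

definition cov_meagre :: "(('a::wellorder) \<Rightarrow> 'a) set rel" where
  "cov_meagre = (SOME \<kappa>. (\<exists>\<A> :: ('a \<Rightarrow> 'a) set set. meagre_cover \<A> \<and> \<kappa> = |\<A>| ) \<and>
                          (\<forall>\<A> :: ('a \<Rightarrow> 'a) set set. meagre_cover \<A> \<longrightarrow> \<kappa> \<le>o |\<A>| ))"

lemma openin_lam_topology_nbhd:
  assumes "openin (lam_topology :: ('a::wellorder \<Rightarrow> 'a) topology) U" "f \<in> U"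
  shows "\<exists>\<alpha>. \<forall>g. (\<forall>x<\<alpha>. g x = f x) \<longrightarrow> g \<in> U"
proof -
  have "generate_topology_on (basic_open ` bounded_seqs) U"
    using assms(1) by (simp add: lam_topology_def openin_topology_generated_by_iff)
  then show ?thesis using assms(2)
  proof (induction arbitrary: f)
    case Empty
    then show ?case by simp
  next
    case (Int U V)
    have "f \<in> U" "f \<in> V" using Int.prems by auto
    obtain \<alpha> where "\<forall>g. (\<forall>x<\<alpha>. g x = f x) \<longrightarrow> g \<in> U"
      using Int.IH(1)[OF \<open>f \<in> U\<close>] by (rule exE)
    moreover obtain \<beta> where "\<forall>g. (\<forall>x<\<beta>. g x = f x) \<longrightarrow> g \<in> V"
      using Int.IH(2)[OF \<open>f \<in> V\<close>] by (rule exE)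
    ultimately have "\<forall>g. (\<forall>x<max \<alpha> \<beta>. g x = f x) \<longrightarrow> g \<in> U \<inter> V"
      by (auto simp: less_max_iff_disj)
    then show ?case by blast
  next
    case (UN K)
    obtain k where k: "k \<in> K" "f \<in> k" using UN.prems by blast
    obtain \<alpha> where "\<forall>g. (\<forall>x<\<alpha>. g x = f x) \<longrightarrow> g \<in> k"
      using UN.IH[OF k] by (rule exE)
    then have "\<forall>g. (\<forall>x<\<alpha>. g x = f x) \<longrightarrow> g \<in> \<Union>K"
      using k(1) by blast
    then show ?case by (rule exI)
  next
    case (Basis S)
    then obtain s \<alpha> where s: "S = basic_open s" "dom s = {..<\<alpha>}"
      by (auto simp: bounded_seqs_def)
    have "g \<in> S" if "\<forall>x<\<alpha>. g x = f x" for g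
      using Basis(2) that s by (auto simp: basic_open_def map_le_def)
    then show ?case by blast
  qed
qed

lemma nowhere_dense_singleton:
  fixes f :: "'a::wellorder \<Rightarrow> 'a"
  assumes nomax: "\<And>x::'a. \<exists>y. x < y"
  shows "nowhere_dense_in lam_topology {f}"
proof -
  have seq: "(\<lambda>y. if y \<le> x then Some (g y) else None) \<in> bounded_seqs" for x :: 'a and g
  proof -
    have "x < (LEAST y. x < y)"
      using nomax[of x] by (metis LeastI)
    then have "dom (\<lambda>y. if y \<le> x then Some (g y) else None) = {..<(LEAST y. x < y)}"
      by (auto split: if_splits dest: not_less_Least le_less_trans)
    then show ?thesis
      unfolding bounded_seqs_def by blast
  qed
  have mem: "g \<in> basic_open (\<lambda>y. if y \<le> x then Some (g y) else None)" for g :: "'a \<Rightarrow> 'a" and x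
    by (auto simp: basic_open_def map_le_def split: if_splits)
  have opn: "openin lam_topology (basic_open (\<lambda>y. if y \<le> x then Some (g y) else None))"
    for g :: "'a \<Rightarrow> 'a" and x
    unfolding lam_topology_def by (rule topology_generated_by_Basis) (use seq in blast)
  have top: "topspace (lam_topology :: ('a \<Rightarrow> 'a) topology) = UNIV"
    using mem openin_subset[OF opn] by blast
  have "g = f" if g: "g \<in> lam_topology closure_of {f}" for g
  proof
    fix x
    have "f \<in> basic_open (\<lambda>y. if y \<le> x then Some (g y) else None)"
      using g mem[of g x] opn[of x g] by (auto simp: in_closure_of)
    then have "(\<lambda>y. if y \<le> x then Some (g y) else None) x = Some (f x)"
      unfolding basic_open_def map_le_def by (force split: if_splits)
    then show "g x = f x" by simp
  qed
  then have cl: "lam_topology closure_of {f} \<subseteq> {f}" by blast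
  have "lam_topology interior_of (lam_topology closure_of {f}) = {}"
  proof (rule ccontr)
    let ?U = "lam_topology interior_of (lam_topology closure_of {f})"
    assume "?U \<noteq> {}"
    moreover have "?U \<subseteq> {f}"
      using interior_of_subset cl by (rule order_trans)
    ultimately have U: "?U = {f}" by blast
    have "\<exists>\<alpha>. \<forall>g. (\<forall>x<\<alpha>. g x = f x) \<longrightarrow> g \<in> ?U"
      by (rule openin_lam_topology_nbhd[OF openin_interior_of]) (simp only: U singleton_iff)
    then obtain \<alpha> where \<alpha>: "\<And>g. (\<forall>x<\<alpha>. g x = f x) \<Longrightarrow> g = f"
      unfolding U singleton_iff by blast
    obtain y where "f \<alpha> < y" using nomax by blast
    moreover have "f(\<alpha> := y) = f" by (rule \<alpha>) auto
    ultimately show False by (metis fun_upd_same less_irrefl)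
  qed
  then show ?thesis by (simp add: nowhere_dense_in_def top)
qed

lemma Field_lam [simp]: "Field lam = UNIV"
  by (auto simp: lam_def Field_def)

lemma lam_no_max:
  assumes "Card_order (lam :: ('a::wellorder) rel)" "infinite (UNIV :: 'a set)"
  shows "\<exists>y. (x::'a) < y"
proof -
  have "\<exists>y\<in>Field (lam :: 'a rel). x \<noteq> y \<and> (x, y) \<in> lam"
    by (rule infinite_Card_order_limit) (use assms in simp_all)
  then obtain y where "x \<noteq> y" "x \<le> y" by (auto simp: lam_def)
  then show ?thesis by (auto simp: order.strict_iff_order)
qed

lemma cov_meagre_attained:
  assumes "Card_order (lam :: ('a::wellorder) rel)" "infinite (UNIV :: 'a set)"
  shows "\<exists>\<A> :: ('a \<Rightarrow> 'a) set set. meagre_cover \<A> \<and> cov_meagre = |\<A>|"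
    and "\<And>\<A> :: ('a \<Rightarrow> 'a) set set. meagre_cover \<A> \<Longrightarrow> (cov_meagre :: ('a \<Rightarrow> 'a) set rel) \<le>o |\<A>|"
proof -
  let ?R = "{ |\<A>| | \<A> :: ('a \<Rightarrow> 'a) set set. meagre_cover \<A>}"
  have "meagre_cover (range (\<lambda>f :: 'a \<Rightarrow> 'a. {f}))"
    using nowhere_dense_singleton[OF lam_no_max[OF assms]]
    by (auto simp: meagre_cover_def intro: meagre_ideal.nowhere_dense)
  then have "?R \<noteq> {}" by blast
  moreover have "\<forall>r\<in>?R. Card_order r" using card_of_Card_order by blast
  ultimately have "\<exists>r\<in>?R. \<forall>r'\<in>?R. r \<le>o r'"
    by (rule exists_minim_Card_order)
  then have "\<exists>\<kappa>. (\<exists>\<A> :: ('a \<Rightarrow> 'a) set set. meagre_cover \<A> \<and> \<kappa> = |\<A>| ) \<and>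
      (\<forall>\<A> :: ('a \<Rightarrow> 'a) set set. meagre_cover \<A> \<longrightarrow> \<kappa> \<le>o |\<A>| )"
    by blast
  from someI_ex[OF this]
  have spec: "(\<exists>\<A> :: ('a \<Rightarrow> 'a) set set. meagre_cover \<A> \<and> cov_meagre = |\<A>| ) \<and>
      (\<forall>\<A> :: ('a \<Rightarrow> 'a) set set. meagre_cover \<A> \<longrightarrow> (cov_meagre :: ('a \<Rightarrow> 'a) set rel) \<le>o |\<A>| )"
    unfolding cov_meagre_def .
  show "\<exists>\<A> :: ('a \<Rightarrow> 'a) set set. meagre_cover \<A> \<and> cov_meagre = |\<A>|"
    and "\<And>\<A> :: ('a \<Rightarrow> 'a) set set. meagre_cover \<A> \<Longrightarrow> (cov_meagre :: ('a \<Rightarrow> 'a) set rel) \<le>o |\<A>|"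
    using spec by blast+
qed

lemma lam_Restr_Well_order: "Well_order (Restr (lam :: ('a::wellorder) rel) A)"
  and Field_lam_Restr: "Field (Restr (lam :: 'a rel) A) = A"
proof -
  have "Well_order (lam :: 'a rel)"
  proof -
    have "(lam :: 'a rel) - Id = {(x, y). x < y}"
      by (auto simp: lam_def)
    then have "wf ((lam :: 'a rel) - Id)"
      by (simp only: wf)
    moreover have "refl (lam :: 'a rel)" "trans (lam :: 'a rel)" "antisym (lam :: 'a rel)"
        "total (lam :: 'a rel)"
      by (auto simp: lam_def intro!: reflI transI antisymI simp: total_on_def)
    ultimately show ?thesis
      by (simp add: well_order_on_def linear_order_on_def partial_order_on_def preorder_on_def)
  qed
  then show "Well_order (Restr (lam :: 'a rel) A)"
    by (rule Well_order_Restr)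
  show "Field (Restr (lam :: 'a rel) A) = A"
    by (auto simp: lam_def Field_def)
qed

text \<open>The description in \<open>ord_add_def\<close> determines a unique ordinal below an infinite cardinal.\<close>

lemma ord_add_unique_existence:
  fixes \<alpha> \<beta> :: "'a::wellorder"
  assumes card: "Card_order (lam :: 'a rel)" and inf: "infinite (UNIV :: 'a set)"
  shows "\<exists>!\<gamma>. \<alpha> \<le> \<gamma> \<and> Restr lam {\<alpha>..<\<gamma>} =o Restr lam {..<\<beta>}"
proof -
  let ?T = "Restr lam {\<alpha>..}"
  have wT: "Well_order ?T" by (rule lam_Restr_Well_order)
  have wl: "Well_order (lam :: 'a rel)" using lam_Restr_Well_order[of UNIV] by simp
  have und: "Restr ?T (underS ?T \<gamma>) = Restr lam {\<alpha>..<\<gamma>}" if "\<alpha> \<le> \<gamma>" for \<gamma>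
    using that by (auto simp: underS_def lam_def)
  have seg: "Restr lam {..<\<beta>} <o (lam :: 'a rel)"
  proof -
    have "underS lam \<beta> = {..<\<beta>}"
      by (auto simp: underS_def lam_def)
    then show ?thesis
      using underS_Restr_ordLess[OF wl, of \<beta>] by simp
  qed
  have cT: "|{\<alpha>..}| =o |UNIV :: 'a set|"
  proof -
    have split: "{..<\<alpha>} \<union> {\<alpha>..} = UNIV" by auto
    have "underS lam \<alpha> = {..<\<alpha>}"
      by (auto simp: underS_def lam_def)
    then have "|{..<\<alpha>}| <o |UNIV :: 'a set|"
      using card_of_underS[OF card, of \<alpha>] ordLess_ordIso_trans
        card_of_Field_ordIso[OF card] ordIso_symmetric by fastforce
    then have "\<not> |{\<alpha>..}| <o |UNIV :: 'a set|"
      using card_of_Un_ordLess_infinite[OF inf, of "{..<\<alpha>}" "{\<alpha>..}"] ordLess_irreflexive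
        split by auto
    then show ?thesis
      by (meson card_of_mono1 card_of_Well_order not_ordLess_iff_ordLeq ordIso_iff_ordLeq subset_UNIV)
  qed
  have "(lam :: 'a rel) =o |UNIV :: 'a set|"
    using card_of_Field_ordIso[OF card] ordIso_symmetric by simp
  also have "|UNIV :: 'a set| =o |{\<alpha>..}|"
    using cT ordIso_symmetric by blast
  also have "|{\<alpha>..}| \<le>o ?T"
    using card_of_least[of "{\<alpha>..}" ?T] wT Field_lam_Restr[of "{\<alpha>..}"] by simp
  finally have "(lam :: 'a rel) \<le>o ?T" .
  with seg have "Restr lam {..<\<beta>} <o ?T"
    by (rule ordLess_ordLeq_trans)
  then obtain \<gamma> where \<gamma>: "\<gamma> \<in> Field ?T" "Restr lam {..<\<beta>} =o Restr ?T (underS ?T \<gamma>)"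
    using ordLess_iff_ordIso_Restr[OF wT lam_Restr_Well_order] by blast
  then have "\<alpha> \<le> \<gamma>" by (simp only: Field_lam_Restr atLeast_iff)
  show ?thesis
  proof (rule ex1I[of _ \<gamma>])
    show *: "\<alpha> \<le> \<gamma> \<and> Restr lam {\<alpha>..<\<gamma>} =o Restr lam {..<\<beta>}"
      using \<gamma> \<open>\<alpha> \<le> \<gamma>\<close> und ordIso_symmetric by metis
    have less: False if "\<alpha> \<le> x" "x < y" "Restr lam {\<alpha>..<x} =o Restr lam {..<\<beta>}"
      "Restr lam {\<alpha>..<y} =o Restr lam {..<\<beta>}" for x y
    proof -
      let ?Y = "Restr lam {\<alpha>..<y}"
      have "Restr ?Y (underS ?Y x) <o ?Y"
        by (rule underS_Restr_ordLess[OF lam_Restr_Well_order])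
          (use that in \<open>auto simp: Field_lam_Restr\<close>)
      moreover have "Restr ?Y (underS ?Y x) = Restr lam {\<alpha>..<x}"
        using that by (auto simp: underS_def lam_def)
      ultimately show False
        using that(3,4) by (metis not_ordLess_ordIso ordIso_symmetric ordIso_transitive)
    qed
    show "\<gamma>' = \<gamma>" if "\<alpha> \<le> \<gamma>' \<and> Restr lam {\<alpha>..<\<gamma>'} =o Restr lam {..<\<beta>}" for \<gamma>'
      using less[of \<gamma> \<gamma>'] less[of \<gamma>' \<gamma>] that * by (metis linorder_neqE)
  qed
qed

end

theory Submission
  imports Defs "HOL-Algebra.Free_Abelian_Groups"
begin

text \<open>
  Cut \<open>\<lambda>\<close> into consecutive blocks of order type \<open>\<omega>\<close> and fix a non-principal ultrafilter on each; the
  resulting set \<open>r\<close> of triples is strongly disjoint, and so is every subset of it. Any ultrafilter \<open>H\<close> on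
  the set \<open>r\<close> all of whose members have size \<open>\<lambda>\<close> is therefore a linked and big subfamily of
  \<open>Q_zero\<close>, and \<open>fil(H)\<close> is the sum of the block ultrafilters along \<open>H\<close>.

  The covering number serves only to make \<open>fil(H)\<close> weakly reasonable. For \<open>g : \<lambda> \<rightarrow> \<lambda>\<close> let \<open>C\<^sub>g\<close> be the
  club of closure points of \<open>g\<close>. Given \<open>f\<close> and an unbounded \<open>B \<subseteq> r\<close>, for all \<open>g\<close> outside
  a meagre set unboundedly many blocks of \<open>B\<close> miss \<open>\<Union>{[\<delta>, \<delta> + f(\<delta>)) : \<delta> \<in> C\<^sub>g}\<close>: a value \<open>g(\<gamma>)\<close> above
  such a block keeps \<open>C\<^sub>g\<close> out of the interval between \<open>\<gamma>\<close> and the end of the block. As fewer than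
  \<open>cov\<close> many meagre sets do not cover, a recursion along all \<open>2\<^sup>\<lambda>\<close> functions \<open>f\<close> picks \<open>g\<^sub>f\<close> such that
  the sets of missed blocks have unbounded finite intersections, and \<open>H\<close> is an ultrafilter
  containing them.
\<close>

section \<open>Ultrafilters\<close>

lemma ultrafilter_extending:
  assumes "E \<subseteq> Pow Z" and fip: "\<And>S. S \<subseteq> E \<Longrightarrow> finite S \<Longrightarrow> Z \<inter> \<Inter>S \<noteq> {}"
  shows "\<exists>d. ultrafilter_on Z d \<and> E \<subseteq> d"
proof -
  let ?F = "{M. E \<subseteq> M \<and> M \<subseteq> Pow Z \<and> (\<forall>S. S \<subseteq> M \<and> finite S \<longrightarrow> Z \<inter> \<Inter>S \<noteq> {})}"
  have "\<exists>M\<in>?F. \<forall>X\<in>?F. M \<subseteq> X \<longrightarrow> X = M"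
  proof (rule subset_Zorn_nonempty)
    show "?F \<noteq> {}" using assms by blast
  next
    fix \<C> assume ne: "\<C> \<noteq> {}" and ch: "subset.chain ?F \<C>"
    have sub: "\<C> \<subseteq> ?F" using ch by (simp add: subset.chain_def)
    have "Z \<inter> \<Inter>S \<noteq> {}" if S: "S \<subseteq> \<Union>\<C>" "finite S" for S
    proof -
      obtain X where "X \<in> \<C>" "S \<subseteq> X"
        using finite_subset_Union_chain[OF S(2,1) ne ch] by blast
      then show ?thesis using sub S(2) by blast
    qed
    moreover have "E \<subseteq> \<Union>\<C>" "\<Union>\<C> \<subseteq> Pow Z" using ne sub by fast+
    ultimately show "\<Union>\<C> \<in> ?F" by simp
  qed
  then obtain M where "M \<in> ?F" and max': "\<forall>X\<in>?F. M \<subseteq> X \<longrightarrow> X = M" ..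
  then have M: "E \<subseteq> M" "M \<subseteq> Pow Z" "\<And>S. S \<subseteq> M \<Longrightarrow> finite S \<Longrightarrow> Z \<inter> \<Inter>S \<noteq> {}"
    by simp_all
  have max: "X = M" if "X \<in> ?F" "M \<subseteq> X" for X
    by (rule mp[OF bspec[OF max' that(1)] that(2)])
  have mem: "A \<in> M" if A: "A \<subseteq> Z" "\<And>S. S \<subseteq> M \<Longrightarrow> finite S \<Longrightarrow> A \<inter> \<Inter>S \<noteq> {}" for A
  proof -
    have "Z \<inter> \<Inter>S \<noteq> {}" if S: "S \<subseteq> insert A M" "finite S" for S
    proof -
      have "A \<inter> \<Inter>(S - {A}) \<noteq> {}" using S by (intro A(2)) auto
      then show ?thesis using A(1) by blast
    qed
    moreover have "E \<subseteq> insert A M" "insert A M \<subseteq> Pow Z" using M(1,2) A(1) by auto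
    ultimately have "insert A M = M" by (intro max) auto
    then show ?thesis by blast
  qed
  have inter: "Z \<inter> \<Inter>S \<in> M" if S: "S \<subseteq> M" "finite S" for S
  proof (rule mem)
    fix T assume "T \<subseteq> M" "finite T"
    then have "Z \<inter> \<Inter>(S \<union> T) \<noteq> {}" using S by (intro M(3)) auto
    then show "Z \<inter> \<Inter>S \<inter> \<Inter>T \<noteq> {}" by blast
  qed simp
  have up: "B \<in> M" if "A \<in> M" "A \<subseteq> B" "B \<subseteq> Z" for A B
  proof (rule mem)
    fix T assume "T \<subseteq> M" "finite T"
    then have "Z \<inter> \<Inter>(insert A T) \<noteq> {}" using that by (intro M(3)) auto
    then show "B \<inter> \<Inter>T \<noteq> {}" using that by blast
  qed (rule that)
  have "ultrafilter_on Z M"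
    unfolding ultrafilter_on_def
  proof (intro conjI ballI allI impI)
    show "Z \<in> M" using inter[of "{}"] by simp
    show "{} \<notin> M" using M(3)[of "{{}}"] by auto
    show "A \<inter> B \<in> M" if "A \<in> M" "B \<in> M" for A B
    proof -
      have "Z \<inter> \<Inter>{A, B} \<in> M" by (rule inter) (use that in auto)
      moreover have "Z \<inter> \<Inter>{A, B} = A \<inter> B" using that M(2) by auto
      ultimately show ?thesis by simp
    qed
    show "A \<in> M \<or> Z - A \<in> M" if "A \<subseteq> Z" for A
    proof (cases "\<forall>S. S \<subseteq> M \<and> finite S \<longrightarrow> A \<inter> \<Inter>S \<noteq> {}")
      case True
      then have "A \<in> M" by (intro mem[OF that]) simp
      then show ?thesis ..
    next
      case False
      then obtain S where S: "S \<subseteq> M" "finite S" "A \<inter> \<Inter>S = {}" by auto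
      have "Z - A \<in> M" by (rule up[OF inter[OF S(1,2)]]) (use S(3) in auto)
      then show ?thesis ..
    qed
  qed (use M(2) up in auto)
  then show ?thesis using M(1) by blast
qed

lemma nonprincipal_ultrafilter_exists:
  assumes "infinite Z"
  shows "\<exists>d. ultrafilter_on Z d \<and> nonprincipal_on Z d"
proof -
  let ?E = "(\<lambda>x. Z - {x}) ` Z"
  have "Z \<inter> \<Inter>S \<noteq> {}" if S: "S \<subseteq> ?E" "finite S" for S
  proof -
    obtain X where X: "X \<subseteq> Z" "finite X" "S = (\<lambda>x. Z - {x}) ` X"
      using finite_subset_image[OF S(2,1)] by blast
    have "Z - X \<noteq> {}" using assms X by (metis Diff_eq_empty_iff finite_subset)
    then show ?thesis using X by blast
  qed
  then obtain d where d: "ultrafilter_on Z d" "?E \<subseteq> d"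
    using ultrafilter_extending[of ?E Z] by blast
  have "nonprincipal_on Z d"
    unfolding nonprincipal_on_def
  proof safe
    fix x assume x: "x \<in> Z" "d = {A. A \<subseteq> Z \<and> x \<in> A}"
    then have "Z - {x} \<in> d" using d(2) by blast
    then show False using x(2) by blast
  qed
  with d(1) show ?thesis by blast
qed

section \<open>Unboundedness below a regular uncountable cardinal\<close>

lemma lam_ordIso_UNIV:
  assumes "Card_order (lam :: ('a::wellorder) rel)"
  shows "(lam :: 'a rel) =o |UNIV :: 'a set|"
  using card_of_Field_ordIso[OF assms] ordIso_symmetric by simp

lemma finite_subsets_small:
  assumes "|X| <o r" "natLeq \<le>o r"
  shows "|Fpow X| <o r"
proof (cases "finite X")
  case True
  then have "finite (Fpow X)" by (simp add: Fpow_def)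
  then have "|Fpow X| <o natLeq" by (simp add: finite_iff_ordLess_natLeq)
  then show ?thesis using assms(2) by (rule ordLess_ordLeq_trans)
next
  case False
  then show ?thesis
    using card_of_Fpow_infinite assms(1) ordIso_ordLess_trans by blast
qed

definition ubd :: "('a::wellorder) triple set \<Rightarrow> bool" where
  "ubd r \<longleftrightarrow> (\<forall>\<epsilon>. \<exists>t\<in>r. \<epsilon> \<le> fst t)"

definition closure_points :: "('a::wellorder \<Rightarrow> 'a) \<Rightarrow> 'a set" where
  "closure_points g = {\<delta>. \<forall>\<alpha><\<delta>. g \<alpha> < \<delta>}"

definition covered :: "('a::wellorder \<Rightarrow> 'a) \<Rightarrow> ('a \<Rightarrow> 'a) \<Rightarrow> 'a set" where
  "covered f g = (\<Union>\<delta>\<in>closure_points g. {\<delta>..<ord_add \<delta> (f \<delta>)})"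

definition missed :: "('a::wellorder \<Rightarrow> 'a) \<Rightarrow> ('a \<Rightarrow> 'a) \<Rightarrow> 'a triple set" where
  "missed f g = {t. fst (snd t) \<inter> covered f g = {}}"

lemma subset_Sigma_ult:
  assumes "q \<subseteq> F_ult"
  shows "q \<subseteq> Sigma_ult q"
proof
  fix t assume t: "t \<in> q"
  obtain \<alpha> Z d where tt: "t = (\<alpha>, Z, d)" by (cases t)
  have F: "(\<alpha>, Z, d) \<in> F_ult" using assms t tt by auto
  have "\<exists>(\<alpha>', Z', d')\<in>q. A \<inter> Z' \<in> d'" if "A \<in> d" for A
  proof (rule bexI)
    have "A \<subseteq> Z" using F that by (auto simp: F_ult_def ultrafilter_on_def)
    then show "case t of (\<alpha>', Z', d') \<Rightarrow> A \<inter> Z' \<in> d'" using that tt by (simp add: Int_absorb2)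
  qed (rule t)
  then show "t \<in> Sigma_ult q" using F tt by (simp add: Sigma_ult_def)
qed

lemma fil_familyI:
  assumes "q \<in> H" "\<And>\<alpha> Z d. (\<alpha>, Z, d) \<in> q \<Longrightarrow> \<epsilon> \<le> \<alpha> \<Longrightarrow> A \<inter> Z \<in> d"
  shows "A \<in> fil_family H"
proof -
  have "A \<in> fil q" unfolding fil_def using assms(2) by (intro CollectI exI[of _ \<epsilon>]) auto
  then show ?thesis using assms(1) by (auto simp: fil_family_def)
qed

lemma fil_familyE:
  assumes "A \<in> fil_family H"
  obtains q \<epsilon> where "q \<in> H" "\<And>\<alpha> Z d. (\<alpha>, Z, d) \<in> q \<Longrightarrow> \<epsilon> \<le> \<alpha> \<Longrightarrow> A \<inter> Z \<in> d"
proof -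
  obtain q \<epsilon> where "q \<in> H" "\<forall>(\<alpha>, Z, d)\<in>q. \<epsilon> \<le> \<alpha> \<longrightarrow> A \<inter> Z \<in> d"
    using assms by (auto simp: fil_family_def fil_def)
  then show ?thesis by (intro that[of q \<epsilon>]) auto
qed

locale regular_uncountable =
  fixes dummy :: "'a::wellorder itself"
  assumes card: "Card_order (lam :: 'a rel)"
    and regular: "regularCard (lam :: 'a rel)"
    and uncountable: "cardSuc natLeq \<le>o (lam :: 'a rel)"
begin

lemma natLeq_less: "natLeq <o (lam :: 'a rel)"
  using cardSuc_greater[OF natLeq_Card_order] uncountable ordLess_ordLeq_trans by blast

lemma infinite_UNIV_lam: "infinite (UNIV :: 'a set)"
proof -
  have "natLeq \<le>o |UNIV :: 'a set|"
    using natLeq_less lam_ordIso_UNIV[OF card] ordLess_imp_ordLeq ordLeq_ordIso_trans by blast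
  then show ?thesis using infinite_iff_natLeq_ordLeq by blast
qed

lemma gt_ex_lam: "\<exists>y. (x::'a) < y"
  by (rule lam_no_max[OF card infinite_UNIV_lam])

lemma small_bounded:
  fixes A :: "'a set"
  assumes "|A| <o (lam :: 'a rel)"
  shows "\<exists>u. \<forall>a\<in>A. a < u"
proof (rule ccontr)
  assume *: "\<not> ?thesis"
  have "cofinal A (lam :: 'a rel)"
    unfolding cofinal_def
  proof
    fix a :: 'a
    obtain b where b: "a < b" using gt_ex_lam by blast
    obtain c where "c \<in> A" "b \<le> c" using * by (meson not_le)
    with b show "\<exists>b\<in>A. a \<noteq> b \<and> (a, b) \<in> lam" by (intro bexI[of _ c]) (auto simp: lam_def)
  qed
  then have "|A| =o (lam :: 'a rel)" using regular by (simp add: regularCard_def)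
  then show False using assms not_ordLess_ordIso by blast
qed

lemma initial_segment_small: "|{..<u::'a}| <o (lam :: 'a rel)"
proof -
  have "underS lam u = {..<u}" by (auto simp: underS_def lam_def)
  then show ?thesis using card_of_underS[OF card, of u] by simp
qed

lemma image_initial_segment_bounded: "\<exists>u. \<forall>x\<le>\<gamma>. h x < u" for h :: "'a \<Rightarrow> 'a"
proof -
  obtain \<gamma>' where "\<gamma> < \<gamma>'" using gt_ex_lam by blast
  have "|h ` {..<\<gamma>'}| <o (lam :: 'a rel)"
    by (rule ordLeq_ordLess_trans[OF card_of_image initial_segment_small])
  from small_bounded[OF this] obtain u where "\<forall>a\<in>h ` {..<\<gamma>'}. a < u" ..
  then show ?thesis using \<open>\<gamma> < \<gamma>'\<close> by (meson imageI le_less_trans lessThan_iff)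
qed

lemma countable_bounded:
  fixes A :: "'a set"
  assumes "countable A"
  shows "|A| <o (lam :: 'a rel)" "\<exists>u. \<forall>a\<in>A. a < u"
proof -
  have "|A| \<le>o natLeq"
  proof (rule ordLeq_ordIso_trans[OF _ card_of_nat])
    obtain h :: "'a \<Rightarrow> nat" where "inj_on h A" using assms by (rule countableE)
    then show "|A| \<le>o |UNIV :: nat set|" using card_of_ordLeq by blast
  qed
  then show "|A| <o (lam :: 'a rel)" using natLeq_less ordLeq_ordLess_trans by blast
  then show "\<exists>u. \<forall>a\<in>A. a < u" by (rule small_bounded)
qed

lemma unbounded_card:
  fixes A :: "'a set"
  assumes "\<And>u. \<exists>a\<in>A. u \<le> a"
  shows "|A| =o (lam :: 'a rel)"
proof -
  have "\<not> |A| <o (lam :: 'a rel)" using small_bounded assms by (meson not_le)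
  moreover have "|A| \<le>o (lam :: 'a rel)"
    using card_of_mono1[of A UNIV] lam_ordIso_UNIV[OF card] ordIso_symmetric ordLeq_ordIso_trans by blast
  ultimately show ?thesis using ordLeq_iff_ordLess_or_ordIso by blast
qed

lemma club_closure_points: "club (closure_points g)" for g :: "'a \<Rightarrow> 'a"
  unfolding club_def
proof (intro conjI allI impI)
  fix \<alpha> :: 'a
  have "\<exists>u. x < u \<and> (\<forall>y\<le>x. g y < u)" for x
  proof -
    obtain u v where "\<forall>y\<le>x. g y < u" "x < v"
      using image_initial_segment_bounded[of x g] gt_ex_lam by blast
    then show ?thesis by (intro exI[of _ "max u v"]) (auto simp: less_max_iff_disj)
  qed
  then obtain k where k: "\<And>x. x < k x" "\<And>x y. y \<le> x \<Longrightarrow> g y < k x" by metis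
  define s where "s n = (k ^^ n) \<alpha>" for n :: nat
  have "\<exists>u. \<forall>a\<in>range s. a < u" by (rule countable_bounded) simp
  then have ex: "\<exists>u. \<forall>n. s n < u" by blast
  define \<beta> where "\<beta> = (LEAST u. \<forall>n. s n < u)"
  have \<beta>: "s n < \<beta>" for n using LeastI_ex[OF ex] unfolding \<beta>_def by blast
  have "\<beta> \<in> closure_points g"
    unfolding closure_points_def
  proof (intro CollectI allI impI)
    fix x assume "x < \<beta>"
    then have "\<not> (\<forall>n. s n < x)" unfolding \<beta>_def by (rule not_less_Least)
    then obtain n where "x \<le> s n" by (auto simp: not_less)
    then have "g x < s (Suc n)" using k(2) by (simp add: s_def)
    then show "g x < \<beta>" using \<beta> less_trans by blast
  qed
  moreover have "\<alpha> \<le> \<beta>" using \<beta>[of 0] by (simp add: s_def)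
  ultimately show "\<exists>\<beta>\<in>closure_points g. \<alpha> \<le> \<beta>" by blast
next
  fix \<delta> :: 'a
  assume "(\<exists>\<alpha>. \<alpha> < \<delta>) \<and> (\<forall>\<alpha><\<delta>. \<exists>\<beta>\<in>closure_points g. \<alpha> < \<beta> \<and> \<beta> < \<delta>)"
  then show "\<delta> \<in> closure_points g"
    unfolding closure_points_def by (blast intro: less_trans)
qed

section \<open>Blocks of order type omega\<close>

definition block :: "'a \<Rightarrow> 'a set" where
  "block \<alpha> = {y. \<alpha> \<le> y \<and> finite {\<alpha>..<y}}"

definition block_starts :: "'a set" where
  "block_starts = {\<alpha>. \<forall>\<beta><\<alpha>. infinite {\<beta>..<\<alpha>}}"

lemma infinite_block: "infinite (block \<alpha>)"
proof
  assume fin: "finite (block \<alpha>)"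
  have "\<alpha> \<in> block \<alpha>" by (simp add: block_def)
  then have m: "Max (block \<alpha>) \<in> block \<alpha>" using fin by (intro Max_in) auto
  define y where "y = (LEAST y. Max (block \<alpha>) < y)"
  have y: "Max (block \<alpha>) < y"
    unfolding y_def by (rule LeastI_ex[OF gt_ex_lam])
  have "{\<alpha>..<y} \<subseteq> insert (Max (block \<alpha>)) {\<alpha>..<Max (block \<alpha>)}"
    unfolding y_def by (auto dest!: not_less_Least[of _ "\<lambda>y. Max (block \<alpha>) < y"])
  then have "finite {\<alpha>..<y}" using m by (auto simp: block_def intro: finite_subset)
  then have "y \<in> block \<alpha>" using m y by (auto simp: block_def)
  then show False using y fin Max_ge not_le by blast
qed

lemma countable_block: "countable (block \<alpha>)"
proof -
  have "card {\<alpha>..<x} < card {\<alpha>..<y}" if "x \<in> block \<alpha>" "y \<in> block \<alpha>" "x < y" for x y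
    using that by (intro psubset_card_mono) (auto simp: block_def)
  then have "inj_on (\<lambda>y. card {\<alpha>..<y}) (block \<alpha>)"
    by (intro inj_onI) (metis less_irrefl linorder_neqE)
  then show ?thesis by (rule countableI)
qed

lemma block_starts_unbounded: "\<exists>\<alpha>\<in>block_starts. \<beta> \<le> \<alpha>"
proof -
  have "\<exists>u. \<forall>a\<in>block \<beta>. a < u" by (rule countable_bounded(2)[OF countable_block])
  then obtain u where u: "\<forall>a\<in>block \<beta>. a < u" ..
  have "\<beta> \<in> block \<beta>" by (simp add: block_def)
  then have "\<beta> \<le> u" using u by (blast intro: less_imp_le)
  moreover have "u \<notin> block \<beta>" using u by blast
  ultimately have "\<beta> \<le> u \<and> infinite {\<beta>..<u}" by (simp add: block_def)
  then have ex: "\<exists>u. \<beta> \<le> u \<and> infinite {\<beta>..<u}" ..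
  define \<alpha> where "\<alpha> = (LEAST u. \<beta> \<le> u \<and> infinite {\<beta>..<u})"
  have \<alpha>: "\<beta> \<le> \<alpha>" "infinite {\<beta>..<\<alpha>}" using LeastI_ex[OF ex] unfolding \<alpha>_def by auto
  have "infinite {\<gamma>..<\<alpha>}" if "\<gamma> < \<alpha>" for \<gamma>
  proof
    assume fin: "finite {\<gamma>..<\<alpha>}"
    have "finite {\<beta>..<\<gamma>}"
      using that not_less_Least[of \<gamma> "\<lambda>u. \<beta> \<le> u \<and> infinite {\<beta>..<u}"] unfolding \<alpha>_def by force
    moreover have "{\<beta>..<\<alpha>} \<subseteq> {\<beta>..<\<gamma>} \<union> {\<gamma>..<\<alpha>}" by auto
    ultimately show False using fin \<alpha>(2) by (meson finite_UnI finite_subset)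
  qed
  then show ?thesis using \<alpha>(1) by (auto simp: block_starts_def)
qed

lemma block_ends_before:
  assumes "\<alpha> < \<beta>" "\<beta> \<in> block_starts"
  shows "block \<alpha> \<subseteq> {..<\<beta>}"
proof
  fix y assume y: "y \<in> block \<alpha>"
  show "y \<in> {..<\<beta>}"
  proof (rule ccontr)
    assume "y \<notin> {..<\<beta>}"
    then have "{\<alpha>..<\<beta>} \<subseteq> {\<alpha>..<y}" by auto
    moreover have "finite {\<alpha>..<y}" using y by (simp add: block_def)
    ultimately have "finite {\<alpha>..<\<beta>}" by (rule finite_subset)
    then show False using assms by (simp add: block_starts_def)
  qed
qed

lemma ubd_strongly_disjoint_in_Q_zero:
  assumes sub: "r \<subseteq> F_ult" and sd: "strongly_disjoint r" and "ubd r"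
  shows "(r :: 'a triple set) \<in> Q_zero"
proof -
  have inj: "inj_on fst r" using sd by (auto simp: strongly_disjoint_def inj_on_def)
  have f: "|fst ` r| =o (lam :: 'a rel)"
    using \<open>ubd r\<close> by (intro unbounded_card) (auto simp: ubd_def)
  have "|r| =o |fst ` r|"
    using inj by (metis card_of_ordIso inj_on_imp_bij_betw)
  then have "|r| =o (lam :: 'a rel)" using f ordIso_transitive by blast
  moreover have "|{t \<in> r. fst t = \<alpha>}| <o (lam :: 'a rel)" for \<alpha>
  proof -
    have "finite {t \<in> r. fst t = \<alpha>}"
      using inj by (intro inj_on_finite[of fst _ "{\<alpha>}"]) (auto simp: inj_on_def)
    then have "|{t \<in> r. fst t = \<alpha>}| <o natLeq" by (simp add: finite_iff_ordLess_natLeq)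
    then show ?thesis using natLeq_less ordLess_transitive by blast
  qed
  ultimately show "r \<in> Q_zero" using sub sd by (simp add: Q_zero_def Q_star_def)
qed

lemma strongly_disjoint_ubd_exists:
  "\<exists>r :: 'a triple set. r \<subseteq> F_ult \<and> strongly_disjoint r \<and> ubd r"
proof -
  obtain d where d: "ultrafilter_on (block \<alpha>) (d \<alpha>)" "nonprincipal_on (block \<alpha>) (d \<alpha>)" for \<alpha>
    using nonprincipal_ultrafilter_exists[OF infinite_block] by metis
  let ?r = "(\<lambda>\<alpha>. (\<alpha>, block \<alpha>, d \<alpha>)) ` block_starts"
  have "\<alpha> = (LEAST z. z \<in> block \<alpha>)" for \<alpha>
    by (rule sym, rule Least_equality) (auto simp: block_def)
  then have "?r \<subseteq> F_ult"
    using d infinite_block countable_bounded(1)[OF countable_block] by (auto simp: F_ult_def)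
  moreover have "strongly_disjoint ?r"
    using block_ends_before unfolding strongly_disjoint_def by fastforce
  moreover have "ubd ?r"
    using block_starts_unbounded by (auto simp: ubd_def)
  ultimately show ?thesis by blast
qed

section \<open>Meagre sets and the generic clubs\<close>

lemma openin_restriction:
  "openin lam_topology {g. \<forall>x\<le>\<alpha>. g x = h x}" for h :: "'a \<Rightarrow> 'a"
proof -
  let ?s = "\<lambda>y. if y \<le> \<alpha> then Some (h y) else None"
  have "\<alpha> < (LEAST y. \<alpha> < y)" by (rule LeastI_ex[OF gt_ex_lam])
  then have "dom ?s = {..<(LEAST y. \<alpha> < y)}"
    by (auto split: if_splits dest: not_less_Least le_less_trans)
  then have "?s \<in> bounded_seqs" unfolding bounded_seqs_def by blast
  then have "openin lam_topology (basic_open ?s)"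
    unfolding lam_topology_def by (intro topology_generated_by_Basis) blast
  moreover have "basic_open ?s = {g. \<forall>x\<le>\<alpha>. g x = h x}"
    by (force simp: basic_open_def map_le_def split: if_splits)
  ultimately show ?thesis by simp
qed

lemma nowhere_dense_inI:
  fixes N :: "('a \<Rightarrow> 'a) set"
  assumes ext: "\<And>\<alpha> h. \<exists>b. \<forall>g. (\<forall>x<\<alpha>. g x = h x) \<and> g \<alpha> = b \<longrightarrow> g \<notin> N"
  shows "nowhere_dense_in lam_topology N"
proof -
  have "topspace (lam_topology :: ('a \<Rightarrow> 'a) topology) = UNIV"
    using openin_subset[OF openin_restriction] by blast
  moreover have "h \<notin> lam_topology interior_of (lam_topology closure_of N)" for h
  proof
    let ?U = "lam_topology interior_of (lam_topology closure_of N)"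
    assume "h \<in> ?U"
    then obtain \<alpha> where \<alpha>: "\<forall>g. (\<forall>x<\<alpha>. g x = h x) \<longrightarrow> g \<in> ?U"
      using openin_lam_topology_nbhd[OF openin_interior_of] by blast
    obtain b where b: "\<And>g. (\<forall>x<\<alpha>. g x = h x) \<Longrightarrow> g \<alpha> = b \<Longrightarrow> g \<notin> N"
      using ext[of \<alpha> h] by blast
    let ?V = "{g. \<forall>x\<le>\<alpha>. g x = (h(\<alpha> := b)) x}"
    have "h(\<alpha> := b) \<in> ?U" using \<alpha> by auto
    then have "h(\<alpha> := b) \<in> lam_topology closure_of N"
      by (rule subsetD[OF interior_of_subset])
    then have "\<forall>T. h(\<alpha> := b) \<in> T \<and> openin lam_topology T \<longrightarrow> (\<exists>y. y \<in> N \<and> y \<in> T)"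
      by (simp add: in_closure_of)
    then have "\<exists>y. y \<in> N \<and> y \<in> ?V"
      by (elim allE[of _ ?V] mp) (intro conjI openin_restriction CollectI allI impI refl)
    then obtain g where g: "g \<in> N" "g \<in> ?V" by blast
    then have "\<forall>x<\<alpha>. g x = h x" "g \<alpha> = b" by auto
    then show False using b g(1) by blast
  qed
  ultimately show ?thesis by (auto simp: nowhere_dense_in_def)
qed

lemma disjoint_from_covered:
  fixes f g :: "'a \<Rightarrow> 'a"
  assumes "Z \<subseteq> {b..<c}" "c \<le> g \<gamma>" "\<And>\<delta>. \<delta> \<le> \<gamma> \<Longrightarrow> ord_add \<delta> (f \<delta>) \<le> b"
  shows "Z \<inter> covered f g = {}"
proof -
  have False if \<delta>: "z \<in> Z" "\<delta> \<in> closure_points g" "\<delta> \<le> z" "z < ord_add \<delta> (f \<delta>)" for z \<delta>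
  proof -
    have z: "b \<le> z" "z < c" using \<delta>(1) assms(1) by auto
    show False
    proof (cases "\<delta> \<le> \<gamma>")
      case True
      then have "z < b" using \<delta>(4) assms(3) less_le_trans by blast
      then show False using z by simp
    next
      case False
      then have "g \<gamma> < \<delta>" using \<delta>(2) by (simp add: closure_points_def)
      then show False using z \<delta>(3) assms(2) by simp
    qed
  qed
  then show ?thesis by (fastforce simp: covered_def)
qed

lemma not_ubd_missed_meagre:
  assumes B: "B \<subseteq> F_ult" "ubd B"
  shows "{g :: 'a \<Rightarrow> 'a. \<not> ubd (B \<inter> missed f g)} \<in> meagre_ideal"
proof -
  define N where "N \<epsilon> = {g :: 'a \<Rightarrow> 'a. \<forall>t\<in>B. \<epsilon> \<le> fst t \<longrightarrow> t \<notin> missed f g}" for \<epsilon>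
  have "nowhere_dense_in lam_topology (N \<epsilon>)" for \<epsilon>
  proof (rule nowhere_dense_inI)
    fix \<gamma> :: 'a and h :: "'a \<Rightarrow> 'a"
    obtain u where u: "\<And>\<delta>. \<delta> \<le> \<gamma> \<Longrightarrow> ord_add \<delta> (f \<delta>) < u"
      using image_initial_segment_bounded[of \<gamma> "\<lambda>\<delta>. ord_add \<delta> (f \<delta>)"] by blast
    obtain t where t: "t \<in> B" "max \<epsilon> u \<le> fst t"
      using B(2) unfolding ubd_def by blast
    obtain \<beta> Z d where tt: "t = (\<beta>, Z, d)" by (cases t)
    have Z: "|Z| <o (lam :: 'a rel)" "\<beta> = (LEAST z. z \<in> Z)"
      using t(1) B(1) tt by (auto simp: F_ult_def)
    obtain c where c: "\<forall>z\<in>Z. z < c" using small_bounded[OF Z(1)] ..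
    have sub: "Z \<subseteq> {\<beta>..<c}" using c Z(2) by (auto intro: Least_le)
    have "g \<notin> N \<epsilon>" if "g \<gamma> = c" for g
    proof -
      have "Z \<inter> covered f g = {}"
        using t(2) u that tt
        by (intro disjoint_from_covered[OF sub, of _ \<gamma>]) (auto intro: less_imp_le less_le_trans)
      then show ?thesis using t tt by (auto simp: N_def missed_def intro!: bexI[of _ t])
    qed
    then show "\<exists>b. \<forall>g. (\<forall>x<\<gamma>. g x = h x) \<and> g \<gamma> = b \<longrightarrow> g \<notin> N \<epsilon>" by blast
  qed
  then have "\<forall>A\<in>range N. A \<in> meagre_ideal" by (auto intro: meagre_ideal.nowhere_dense)
  moreover have "|range N| <o cardSuc (lam :: 'a rel)"
  proof -
    have "|range N| \<le>o (lam :: 'a rel)"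
      using card_of_image[of N UNIV] lam_ordIso_UNIV[OF card] ordIso_symmetric ordLeq_ordIso_trans by blast
    then show ?thesis using cardSuc_greater[OF card] ordLeq_ordLess_trans by blast
  qed
  ultimately have "\<Union>(range N) \<in> meagre_ideal" by (rule meagre_ideal.Union)
  moreover have "{g. \<not> ubd (B \<inter> missed f g)} = \<Union>(range N)"
    by (auto simp: N_def ubd_def)
  ultimately show ?thesis by simp
qed

lemma generic_function_exists:
  fixes \<B> :: "'i \<Rightarrow> 'a triple set"
  assumes "|I| <o (cov_meagre :: ('a \<Rightarrow> 'a) set rel)"
    and "\<And>i. i \<in> I \<Longrightarrow> \<B> i \<subseteq> F_ult" "\<And>i. i \<in> I \<Longrightarrow> ubd (\<B> i)"
  shows "\<exists>g. \<forall>i\<in>I. ubd (\<B> i \<inter> missed f g)"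
proof (rule ccontr)
  assume *: "\<not> ?thesis"
  let ?A = "(\<lambda>i. {g. \<not> ubd (\<B> i \<inter> missed f g)}) ` I"
  have "?A \<subseteq> meagre_ideal" using not_ubd_missed_meagre assms(2,3) by blast
  moreover have "\<Union>?A = UNIV" using * by blast
  ultimately have "(cov_meagre :: ('a \<Rightarrow> 'a) set rel) \<le>o |?A|"
    by (intro cov_meagre_attained(2)[OF card infinite_UNIV_lam]) (simp add: meagre_cover_def)
  then have "(cov_meagre :: ('a \<Rightarrow> 'a) set rel) \<le>o |I|"
    using card_of_image ordLeq_transitive by blast
  then show False using assms(1) not_ordLess_ordLeq by blast
qed

lemma card_functions: "|UNIV :: ('a \<Rightarrow> 'a) set| \<le>o ctwo ^c (lam :: 'a rel)"
proof -
  have "inj (\<lambda>h :: 'a \<Rightarrow> 'a. {(x, h x) | x. True})" by (rule injI) (auto simp: set_eq_iff)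
  then have "|UNIV :: ('a \<Rightarrow> 'a) set| \<le>o |Pow (UNIV :: ('a \<times> 'a) set)|"
    by (intro card_of_ordLeqI) auto
  also have "|Pow (UNIV :: ('a \<times> 'a) set)| =o |Pow (UNIV :: 'a set)|"
  proof -
    have "|UNIV \<times> UNIV :: ('a \<times> 'a) set| =o |UNIV :: 'a set|"
      by (rule card_of_Times_same_infinite[OF infinite_UNIV_lam])
    then obtain \<phi> where "bij_betw \<phi> (UNIV :: ('a \<times> 'a) set) (UNIV :: 'a set)"
      by (auto simp: card_of_ordIso[symmetric])
    then show ?thesis using bij_betw_Pow card_of_ordIsoI by blast
  qed
  also have "|Pow (UNIV :: 'a set)| =o ctwo ^c (lam :: 'a rel)"
    using card_of_Pow_Func[of "UNIV :: 'a set"] by (simp add: cexp_def ctwo_def Field_card_of)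
  finally show ?thesis .
qed

lemma generic_functions_exist:
  assumes cov: "(cov_meagre :: ('a \<Rightarrow> 'a) set rel) =o ctwo ^c (lam :: 'a rel)"
    and r: "r \<subseteq> F_ult" "ubd (r :: 'a triple set)"
  shows "\<exists>G. \<forall>S. finite S \<longrightarrow> ubd (r \<inter> (\<Inter>f\<in>S. missed f (G f)))"
proof -
  let ?W = "|UNIV :: ('a \<Rightarrow> 'a) set|"
  have wo: "Well_order ?W" by (rule card_of_Well_order)
  have F: "Field ?W = UNIV" by (rule Field_card_of)
  define P where "P G f g \<longleftrightarrow> (\<forall>S \<in> Fpow (underS ?W f).
      ubd (r \<inter> (\<Inter>f'\<in>S. missed f' (G f'))) \<longrightarrow> ubd (r \<inter> (\<Inter>f'\<in>S. missed f' (G f')) \<inter> missed f g))"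
    for G :: "('a \<Rightarrow> 'a) \<Rightarrow> 'a \<Rightarrow> 'a" and f g
  have "\<exists>G. \<forall>f. P G f (G f)"
  proof (rule dependent_wf_choice)
    show "wf (?W - Id)" using wo by (simp add: well_order_on_def)
  next
    fix G G' :: "('a \<Rightarrow> 'a) \<Rightarrow> 'a \<Rightarrow> 'a" and f g
    assume "\<And>z. (z, f) \<in> ?W - Id \<Longrightarrow> G z = G' z"
    then have "(\<Inter>f'\<in>S. missed f' (G f')) = (\<Inter>f'\<in>S. missed f' (G' f'))" if "S \<in> Fpow (underS ?W f)" for S
      using that by (intro INF_cong) (auto simp: Fpow_def underS_def)
    then show "P G f g = P G' f g" unfolding P_def by simp
  next
    fix f :: "'a \<Rightarrow> 'a" and G :: "('a \<Rightarrow> 'a) \<Rightarrow> 'a \<Rightarrow> 'a"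
    let ?I = "{S \<in> Fpow (underS ?W f). ubd (r \<inter> (\<Inter>f'\<in>S. missed f' (G f')))}"
    have "|underS ?W f| <o ?W"
      by (rule card_of_underS[OF card_of_Card_order]) (simp add: F)
    also have "?W \<le>o ctwo ^c (lam :: 'a rel)" by (rule card_functions)
    finally have "|underS ?W f| <o ctwo ^c (lam :: 'a rel)" .
    moreover have "natLeq \<le>o ctwo ^c (lam :: 'a rel)"
      using natLeq_less ordLess_ctwo_cexp[OF card] ordLess_transitive ordLess_imp_ordLeq by blast
    ultimately have "|Fpow (underS ?W f)| <o ctwo ^c (lam :: 'a rel)"
      by (rule finite_subsets_small)
    then have "|Fpow (underS ?W f)| <o (cov_meagre :: ('a \<Rightarrow> 'a) set rel)"
      using cov ordIso_symmetric ordLess_ordIso_trans by blast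
    moreover have "|?I| \<le>o |Fpow (underS ?W f)|" by (rule card_of_mono1) auto
    ultimately have "|?I| <o (cov_meagre :: ('a \<Rightarrow> 'a) set rel)"
      using ordLeq_ordLess_trans by blast
    then have "\<exists>g. \<forall>S\<in>?I. ubd (r \<inter> (\<Inter>f'\<in>S. missed f' (G f')) \<inter> missed f g)"
      by (rule generic_function_exists) (use r(1) in auto)
    then show "\<exists>g. P G f g" unfolding P_def by blast
  qed
  then obtain G where G: "\<And>f. P G f (G f)" by blast
  have "ubd (r \<inter> (\<Inter>f\<in>S. missed f (G f)))" if "finite S" for S
    using that
  proof (induction "card S" arbitrary: S)
    case 0
    then show ?case using r(2) by simp
  next
    case (Suc n)
    have tot: "(f, f') \<in> ?W \<or> (f', f) \<in> ?W" for f f'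
      using wo F by (metis UNIV_I well_order_on_def linear_order_on_def total_on_def
          card_of_Well_order partial_order_on_def preorder_on_def refl_onD)
    have "\<exists>m\<in>S. \<forall>f\<in>S. (f, m) \<in> ?W"
    proof -
      have "\<exists>m\<in>S. \<forall>f\<in>S. (m, f) \<in> ?W - Id \<longrightarrow> False"
      proof -
        have "finite (Restr (?W - Id) S)" using Suc.prems by auto
        moreover have "acyclic (Restr (?W - Id) S)"
          using wo by (meson Int_lower1 acyclic_subset wf_acyclic well_order_on_def)
        ultimately have "wf ((Restr (?W - Id) S)\<inverse>)" by (rule finite_acyclic_wf_converse)
        moreover have "S \<noteq> {}" using Suc.hyps(2) by auto
        ultimately obtain m where "m \<in> S" "\<And>y. (y, m) \<in> (Restr (?W - Id) S)\<inverse> \<Longrightarrow> y \<notin> S"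
          using wfE_min by (metis ex_in_conv)
        then show ?thesis by blast
      qed
      then show ?thesis using tot by blast
    qed
    then obtain m where m: "m \<in> S" "\<And>f. f \<in> S \<Longrightarrow> (f, m) \<in> ?W" by blast
    have "S - {m} \<in> Fpow (underS ?W m)"
      using m Suc.prems by (auto simp: Fpow_def underS_def)
    moreover have "ubd (r \<inter> (\<Inter>f\<in>S - {m}. missed f (G f)))"
      using m Suc by (intro Suc.hyps(1)) auto
    ultimately have "ubd (r \<inter> (\<Inter>f\<in>S - {m}. missed f (G f)) \<inter> missed m (G m))"
      using G[of m] unfolding P_def by blast
    moreover have "r \<inter> (\<Inter>f\<in>S - {m}. missed f (G f)) \<inter> missed m (G m) = r \<inter> (\<Inter>f\<in>S. missed f (G f))"
      using m(1) by blast
    ultimately show ?case by simp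
  qed
  then show ?thesis by blast
qed

section \<open>Sums of ultrafilters\<close>

context
  fixes r :: "'a triple set" and H :: "'a triple set set"
  assumes r: "r \<subseteq> F_ult" "strongly_disjoint r"
    and H: "ultrafilter_on r H" "\<And>q. q \<in> H \<Longrightarrow> ubd q"
begin

lemma members_subset: "q \<in> H \<Longrightarrow> q \<subseteq> r"
  using H(1) by (auto simp: ultrafilter_on_def)

lemma members_Q_zero: "H \<subseteq> Q_zero"
proof
  fix q assume q: "q \<in> H"
  have "strongly_disjoint q"
    using members_subset[OF q] r(2) unfolding strongly_disjoint_def by blast
  then show "q \<in> Q_zero"
    using members_subset[OF q] r(1) H(2)[OF q] by (intro ubd_strongly_disjoint_in_Q_zero) auto
qed

lemma member_properties: "H \<noteq> {}" "H \<subseteq> Q_star"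
  using H(1) members_Q_zero by (auto simp: ultrafilter_on_def Q_zero_def)

lemma big_ultrafilter: "big H"
  unfolding big_def
proof (intro conjI allI impI)
  fix \<D> :: "'a triple set"
  have "r \<inter> \<D> \<in> H \<or> r - r \<inter> \<D> \<in> H" using H(1) by (auto simp: ultrafilter_on_def)
  moreover have "r \<inter> \<D> \<subseteq> \<D>" "(r - r \<inter> \<D>) \<inter> \<D> = {}" by auto
  ultimately show "\<exists>q\<in>H. q \<subseteq> \<D> \<or> q \<inter> \<D> = {}" by (elim disjE) (rule bexI, auto)+
qed (rule member_properties)+

lemma linked_ultrafilter: "linked H"
  unfolding linked_def
proof (intro conjI allI impI)
  fix n :: nat and p :: "nat \<Rightarrow> 'a triple set"
  assume p: "\<forall>i\<le>n. p i \<in> H"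
  have "(\<Inter>i\<le>m. p i) \<in> H" if "m \<le> n" for m
    using that
  proof (induction m)
    case 0
    then show ?case using p by simp
  next
    case (Suc m)
    then have "p (Suc m) \<inter> (\<Inter>i\<le>m. p i) \<in> H" using p H(1) by (auto simp: ultrafilter_on_def)
    then show ?case by (simp add: atMost_Suc)
  qed
  then have mem: "(\<Inter>i\<le>n. p i) \<in> H" by simp
  have "p i \<subseteq> Sigma_ult (p i)" if "i \<le> n" for i
    using p that members_subset r(1) by (intro subset_Sigma_ult) blast
  then have "(\<Inter>i\<le>n. p i) \<subseteq> (\<Inter>i\<le>n. Sigma_ult (p i))" by blast
  then have sub: "fst ` (\<Inter>i\<le>n. p i) \<subseteq> {\<alpha>. \<exists>Z d. (\<alpha>, Z, d) \<in> (\<Inter>i\<le>n. Sigma_ult (p i))}"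
    by (force simp del: INT_iff)
  show "|{\<alpha>. \<exists>Z d. (\<alpha>, Z, d) \<in> (\<Inter>i\<le>n. Sigma_ult (p i))}| =o (lam :: 'a rel)"
  proof (rule unbounded_card)
    fix u
    obtain t where "t \<in> (\<Inter>i\<le>n. p i)" "u \<le> fst t" using H(2)[OF mem] unfolding ubd_def by blast
    then show "\<exists>a\<in>{\<alpha>. \<exists>Z d. (\<alpha>, Z, d) \<in> (\<Inter>i\<le>n. Sigma_ult (p i))}. u \<le> a"
      by (intro bexI[of _ "fst t"] subsetD[OF sub] imageI)
  qed
qed (rule member_properties)+

lemma uniform_ultrafilter_fil_family: "uniform_ultrafilter (fil_family H)"
proof -
  have triple: "ultrafilter_on Z d" "\<alpha> = (LEAST z. z \<in> Z)" if "(\<alpha>, Z, d) \<in> q" "q \<in> H" for \<alpha> Z d q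
    using that members_subset r(1) by (auto simp: F_ult_def)
  have unb: "\<exists>a\<in>A. u \<le> a" if A: "A \<in> fil_family H" for A u
  proof -
    obtain q \<epsilon> where q: "q \<in> H" "\<And>\<alpha> Z d. (\<alpha>, Z, d) \<in> q \<Longrightarrow> \<epsilon> \<le> \<alpha> \<Longrightarrow> A \<inter> Z \<in> d"
      using A by (rule fil_familyE) blast
    obtain t where t: "t \<in> q" "max \<epsilon> u \<le> fst t" using H(2)[OF q(1)] unfolding ubd_def by blast
    obtain \<alpha> Z d where tt: "t = (\<alpha>, Z, d)" by (cases t)
    have "A \<inter> Z \<in> d" using q(2) t tt by auto
    then have "A \<inter> Z \<noteq> {}" using triple(1)[of \<alpha> Z d q] t tt q(1) by (auto simp: ultrafilter_on_def)
    then obtain a where a: "a \<in> A" "a \<in> Z" by blast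
    then have "\<alpha> \<le> a" using triple(2)[of \<alpha> Z d q] t tt q(1) by (auto intro: Least_le)
    moreover have "u \<le> \<alpha>" using t(2) tt by simp
    ultimately show ?thesis using a(1) order_trans by blast
  qed
  have "ultrafilter_on UNIV (fil_family H)"
    unfolding ultrafilter_on_def
  proof (intro conjI ballI allI impI)
    have "UNIV \<in> fil r" using r(1) by (auto simp: fil_def F_ult_def ultrafilter_on_def)
    moreover have "r \<in> H" using H(1) by (simp add: ultrafilter_on_def)
    ultimately show "UNIV \<in> fil_family H" by (auto simp: fil_family_def)
    show "{} \<notin> fil_family H" using unb by blast
  next
    fix A B assume A: "A \<in> fil_family H" and AB: "A \<subseteq> B \<and> B \<subseteq> UNIV"
    obtain q \<epsilon> where q: "q \<in> H" "\<And>\<alpha> Z d. (\<alpha>, Z, d) \<in> q \<Longrightarrow> \<epsilon> \<le> \<alpha> \<Longrightarrow> A \<inter> Z \<in> d"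
      using A by (rule fil_familyE) blast
    have "B \<inter> Z \<in> d" if "(\<alpha>, Z, d) \<in> q" "\<epsilon> \<le> \<alpha>" for \<alpha> Z d
    proof -
      have "A \<inter> Z \<subseteq> B \<inter> Z" "B \<inter> Z \<subseteq> Z" using AB by auto
      then show ?thesis
        using q(2)[OF that] triple(1)[OF that(1) q(1)] unfolding ultrafilter_on_def by blast
    qed
    then show "B \<in> fil_family H" by (rule fil_familyI[OF q(1)])
  next
    fix A B assume A: "A \<in> fil_family H" and B: "B \<in> fil_family H"
    obtain q \<epsilon> where q: "q \<in> H" "\<And>\<alpha> Z d. (\<alpha>, Z, d) \<in> q \<Longrightarrow> \<epsilon> \<le> \<alpha> \<Longrightarrow> A \<inter> Z \<in> d"
      using A by (rule fil_familyE) blast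
    obtain q' \<epsilon>' where q': "q' \<in> H" "\<And>\<alpha> Z d. (\<alpha>, Z, d) \<in> q' \<Longrightarrow> \<epsilon>' \<le> \<alpha> \<Longrightarrow> B \<inter> Z \<in> d"
      using B by (rule fil_familyE) blast
    have "A \<inter> B \<inter> Z \<in> d" if t: "(\<alpha>, Z, d) \<in> q \<inter> q'" "max \<epsilon> \<epsilon>' \<le> \<alpha>" for \<alpha> Z d
    proof -
      have "A \<inter> Z \<in> d" "B \<inter> Z \<in> d" using q(2) q'(2) t by auto
      then have "(A \<inter> Z) \<inter> (B \<inter> Z) \<in> d"
        using triple(1)[of \<alpha> Z d q] q(1) t(1) by (auto simp: ultrafilter_on_def)
      moreover have "(A \<inter> Z) \<inter> (B \<inter> Z) = A \<inter> B \<inter> Z" by blast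
      ultimately show ?thesis by simp
    qed
    moreover have "q \<inter> q' \<in> H" using q(1) q'(1) H(1) by (simp add: ultrafilter_on_def)
    ultimately show "A \<inter> B \<in> fil_family H" by (intro fil_familyI[of "q \<inter> q'"])
  next
    fix A :: "'a set"
    let ?q = "{t \<in> r. A \<inter> fst (snd t) \<in> snd (snd t)}"
    have "?q \<in> H \<or> r - ?q \<in> H" using H(1) by (auto simp: ultrafilter_on_def)
    then show "A \<in> fil_family H \<or> UNIV - A \<in> fil_family H"
    proof
      assume "?q \<in> H"
      then have "A \<in> fil_family H" by (rule fil_familyI) simp
      then show ?thesis ..
    next
      assume q: "r - ?q \<in> H"
      have "(UNIV - A) \<inter> Z \<in> d" if t: "(\<alpha>, Z, d) \<in> r - ?q" for \<alpha> Z d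
      proof -
        have "ultrafilter_on Z d" using triple(1)[OF t q] .
        then have "A \<inter> Z \<subseteq> Z \<longrightarrow> A \<inter> Z \<in> d \<or> Z - A \<inter> Z \<in> d"
          unfolding ultrafilter_on_def by (elim conjE) (rule spec)
        then have "Z - A \<inter> Z \<in> d" using t by simp
        moreover have "Z - A \<inter> Z = (UNIV - A) \<inter> Z" by blast
        ultimately show ?thesis by simp
      qed
      then have "UNIV - A \<in> fil_family H" by (rule fil_familyI[OF q])
      then show ?thesis ..
    qed
  qed simp
  then show ?thesis
    using unb unbounded_card by (simp add: uniform_ultrafilter_def)
qed

lemma weakly_reasonable_fil_family:
  assumes "\<And>f. r \<inter> missed f (G f) \<in> H"
  shows "weakly_reasonable (fil_family H)"
  unfolding weakly_reasonable_def
proof (intro conjI allI impI uniform_ultrafilter_fil_family)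
  fix f :: "'a \<Rightarrow> 'a"
  have "(UNIV - covered f (G f)) \<inter> Z \<in> d" if "(\<alpha>, Z, d) \<in> r \<inter> missed f (G f)" for \<alpha> Z d
  proof -
    have "Z \<in> d" using that r(1) by (auto simp: F_ult_def ultrafilter_on_def)
    moreover have "(UNIV - covered f (G f)) \<inter> Z = Z" using that by (auto simp: missed_def)
    ultimately show ?thesis by simp
  qed
  then have compl: "UNIV - covered f (G f) \<in> fil_family H" by (rule fil_familyI[OF assms])
  have "covered f (G f) \<notin> fil_family H"
  proof
    assume "covered f (G f) \<in> fil_family H"
    then have "covered f (G f) \<inter> (UNIV - covered f (G f)) \<in> fil_family H"
      using compl uniform_ultrafilter_fil_family
      unfolding uniform_ultrafilter_def ultrafilter_on_def by blast
    then have "{} \<in> fil_family H" by simp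
    then show False
      using uniform_ultrafilter_fil_family by (simp add: uniform_ultrafilter_def ultrafilter_on_def)
  qed
  then show "\<exists>C. club C \<and> (\<Union>\<delta>\<in>C. {\<delta>..<ord_add \<delta> (f \<delta>)}) \<notin> fil_family H"
    using club_closure_points unfolding covered_def by blast
qed

end

lemma ubd_ultrafilter_extending:
  fixes r :: "'a triple set"
  assumes sub: "E \<subseteq> Pow r"
    and fip: "\<And>S. S \<subseteq> E \<Longrightarrow> finite S \<Longrightarrow> ubd (r \<inter> \<Inter>S)"
  shows "\<exists>H. ultrafilter_on r H \<and> E \<subseteq> H \<and> (\<forall>q\<in>H. ubd q)"
proof -
  define tail where "tail \<epsilon> = {t \<in> r. \<epsilon> \<le> fst t}" for \<epsilon>
  have "r \<inter> \<Inter>S \<noteq> {}" if S: "S \<subseteq> E \<union> range tail" "finite S" for S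
  proof -
    have "S - E \<subseteq> range tail" "finite (S - E)" using S by auto
    then obtain X where X: "finite X" "S - E = tail ` X" by (metis finite_subset_image)
    obtain u where u: "\<And>x. x \<in> X \<Longrightarrow> x < u"
      using countable_bounded(2)[OF countable_finite[OF X(1)]] by blast
    have "ubd (r \<inter> \<Inter>(S \<inter> E))" using S by (intro fip) auto
    then obtain t where t: "t \<in> r \<inter> \<Inter>(S \<inter> E)" "u \<le> fst t" unfolding ubd_def by blast
    have "t \<in> A" if "A \<in> S" for A
    proof (cases "A \<in> E")
      case False
      then have "A \<in> tail ` X" using that X(2) by blast
      then obtain x where x: "x \<in> X" "A = tail x" by blast
      then have "x \<le> fst t" using u[OF x(1)] t(2) by simp
      then show ?thesis using t(1) x(2) by (simp add: tail_def)
    next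
      case True
      then show ?thesis using t(1) that by simp
    qed
    then show ?thesis using t(1) by blast
  qed
  moreover have "E \<union> range tail \<subseteq> Pow r" using sub by (auto simp: tail_def)
  ultimately obtain H where H: "ultrafilter_on r H" "E \<union> range tail \<subseteq> H"
    using ultrafilter_extending[of "E \<union> range tail" r] by blast
  have "ubd q" if "q \<in> H" for q
    unfolding ubd_def
  proof
    fix \<epsilon>
    have "tail \<epsilon> \<in> H" using H(2) by blast
    then have "q \<inter> tail \<epsilon> \<in> H" using H(1) that by (simp add: ultrafilter_on_def)
    moreover have "{} \<notin> H" using H(1) by (simp add: ultrafilter_on_def)
    ultimately have "q \<inter> tail \<epsilon> \<noteq> {}" by metis
    then show "\<exists>t\<in>q. \<epsilon> \<le> fst t" by (auto simp: tail_def)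
  qed
  then show ?thesis using H by blast
qed

end

theorem theorem2p10:
  assumes "Card_order (lam :: ('a::wellorder) rel)"
    and "regularCard (lam :: 'a rel)"
    and "|bounded_seqs :: ('a \<rightharpoonup> 'a) set| =o (lam :: 'a rel)"
    and "cardSuc natLeq \<le>o (lam :: 'a rel)"
    and "(cov_meagre :: ('a \<Rightarrow> 'a) set rel) =o ctwo ^c (lam :: 'a rel)"
  shows "\<exists>H :: 'a triple set set. H \<subseteq> Q_zero \<and> linked H \<and> big H \<and> weakly_reasonable (fil_family H)"
proof -
  interpret regular_uncountable "TYPE('a)"
    using assms by unfold_locales
  obtain r :: "'a triple set" where r: "r \<subseteq> F_ult" "strongly_disjoint r" "ubd r"
    using strongly_disjoint_ubd_exists by blast
  obtain G where G: "\<And>S. finite S \<Longrightarrow> ubd (r \<inter> (\<Inter>f\<in>S. missed f (G f)))"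
    using generic_functions_exist[OF assms(5) r(1,3)] by blast
  let ?E = "range (\<lambda>f. r \<inter> missed f (G f))"
  have "ubd (r \<inter> \<Inter>S)" if S: "S \<subseteq> ?E" "finite S" for S
  proof -
    obtain X where X: "finite X" "S = (\<lambda>f. r \<inter> missed f (G f)) ` X"
      using finite_subset_image[OF S(2,1)] by blast
    have "r \<inter> \<Inter>S = r \<inter> (\<Inter>f\<in>X. missed f (G f))" using X(2) by blast
    then show ?thesis using G[OF X(1)] by simp
  qed
  then have "\<exists>H. ultrafilter_on r H \<and> ?E \<subseteq> H \<and> (\<forall>q\<in>H. ubd q)"
    by (intro ubd_ultrafilter_extending) auto
  then obtain H where H: "ultrafilter_on r H" "?E \<subseteq> H" "\<And>q. q \<in> H \<Longrightarrow> ubd q"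
    by (elim exE conjE) simp
  note * = r(1,2) H(1,3)
  have "weakly_reasonable (fil_family H)"
    using H(2) by (intro weakly_reasonable_fil_family[OF *]) auto
  then show ?thesis
    by (intro exI[of _ H] conjI members_Q_zero[OF *] linked_ultrafilter[OF *] big_ultrafilter[OF *])
qed

end
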